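(* For the one-dimensional ten-moment Gaussian closure equations with source terms, the DG schemes described in the context (with forward Euler time discretization) are well-balanced (WB) for a general known hydrostatic equilibrium solution, i.e. one satisfying $$(p_{11}^e(x))_x=-\tfrac12\rho^e(x)W_x,\qquad p_{12}^e(x)=C_0\ \text{(a constant)},\qquad u_1^e(x)=u_2^e(x)=0 .$$ Here well-balanced means: if $\mathbf U_h$ is at the (projected) equilibrium state, i.e. on every cell $$\mathbf U_h=\Big(\rho_h^e,\,0,\,0,\,\tfrac12p_{11,h}^e,\,\tfrac12C_0,\,\tfrac12p_{22,h}^e\Big)^\top ,$$ then the right-hand side of the scheme vanishes for all test functions $v\in\mathbb V_h^k$, and hence $\mathbf U_h^{\rm new}=\mathbf U_h$.
   Context: **States.** A state is $\mathbf U=(\rho,m_1,m_2,E_{11},E_{12},E_{22})^\top\in\mathbb R^6$, with $\mathbf m=(m_1,m_2)^\top$ and $\mathbf E$ the symmetric $2\times2$ matrix with entries $E_{11},E_{12},E_{22}$; $\mathbf u=(u_1,u_2)^\top=\mathbf m/\rho$ is the velocity and $\mathbf p=(p_{ij})=2\mathbf E-\mathbf m\mathbf m^\top/\rho$ the symmetric pressure tensor. **Equations.** $\partial_t\mathbf U+\partial_x\mathbf F(\mathbf U)=\mathbf S^x(\mathbf U)$ with $\mathbf F(\mathbf U)=\big(\rho u_1,\rho u_1^2+p_{11},\rho u_1u_2+p_{12},(E_{11}+p_{11})u_1,E_{12}u_1+\tfrac12(p_{11}u_2+p_{12}u_1),E_{22}u_1+p_{12}u_2\big)^\top$ and $\mathbf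 S^x=\big(0,-\tfrac12\rho W_x,0,-\tfrac12\rho u_1W_x,-\tfrac14\rho u_2W_x,0\big)^\top$, $W$ a known potential. **HLLC flux.** $\mathbf F^{hllc}(\cdot,\cdot)$ denotes the HLLC (Harten-Lax-van Leer-contact) numerical flux of the system. It has the following known contact property: if $\mathbf U_L=(\rho_L,0,0,\frac{p_{11}}2,\frac{p_{12}}2,\frac{p_{22,L}}2)^\top$ and $\mathbf U_R=(\rho_R,0,0,\frac{p_{11}}2,\frac{p_{12}}2,\frac{p_{22,R}}2)^\top$, then $\mathbf F^{hllc}(\mathbf U_L,\mathbf U_R)=(0,p_{11},p_{12},0,0,0)^\top$. **Mesh and space.** The domain is partitioned into cells $I_j=(x_{j-1/2},x_{j+1/2})$ of length $h_j$; $\mathbb V_h^k$ is the space of functions that are polynomials of degree up to $k$ on each $I_j$; superscripts $-$ and $+$ at $x_{j+1/2}$ denote left and right limits. $\{x_j^{(\mu)},\omega_\mu\}_{1\le\mu\le N}$ are the $N$-point Gauss quadrature nodes and weights in $I_j$ (weights normalized by $\sum_\mu\omega_\mu=1$). $\overline{(\cdot)}_j$ is the cell average over $I_j$. **Projected equilibrium.** $\rho_h^e$ and $\mathbf p_h^e=\begin{pmatrix}p_{11,h}^e&C_0\\C_0&p_{22,h}^e\end{pmatrix}$ denote the positive (respectively positive-definite) projections of $\rho^e$ and $\mathbf p^e=\begin{pmatrix}p_{11}^e&C_0\\C_0&p_{22}^e\end{pmatrix}$ onto $\mathbb V_h^k$. Put $$p_{11,j+\frac12}^{e,*}=\max\{p_{11,h}^e(x_{j+\frac12}^-),p_{11,h}^e(x_{j+\frac12}^+)\},\qquad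 \mathbf p_{j+\frac12}^{e,\pm,*}=\begin{pmatrix}p_{11,j+\frac12}^{e,*}&C_0\\C_0&p_{22,h}^e(x_{j+\frac12}^\pm)\end{pmatrix},$$ $$\mathbf T_{j+\frac12}^\pm=\begin{pmatrix}t_1^\pm&t_2^\pm\\0&1\end{pmatrix},\quad t_1^\pm=\sqrt{\frac{\det\mathbf p_{j+\frac12}^{e,\pm,*}}{\det\mathbf p_h^e(x_{j+\frac12}^\pm)}},\quad t_2^\pm=\frac{C_0(1-t_1^\pm)}{p_{22,h}^e(x_{j+\frac12}^\pm)},$$ so that $\mathbf p_{j+\frac12}^{e,\pm,*}=\mathbf T_{j+\frac12}^\pm\mathbf p_h^e(x_{j+\frac12}^\pm)(\mathbf T_{j+\frac12}^\pm)^\top$. **Modified flux.** With $\mathbf U_{j+\frac12}^\pm=\mathbf U_h(x_{j+\frac12}^\pm)$, the modified states $\widehat{\mathbf U}_{j+\frac12}^\pm$ have $\widehat\rho=\rho$, $\widehat{\mathbf m}=\mathbf T\mathbf m$, $\widehat{\mathbf E}=\mathbf T\mathbf E\mathbf T^\top$ with $\mathbf T=\mathbf T_{j+\frac12}^\pm$. The numerical flux is $\widehat{\mathbf F}_{j+\frac12}=\mathbf F^{hllc}(\widehat{\mathbf U}_{j+\frac12}^-,\widehat{\mathbf U}_{j+\frac12}^+)$. **Source discretization.** For $w\in\{\rho_h,\,m_{1,h},\,\tfrac12m_{2,h}\}$ (components of $\mathbf U_h$) define $$\langle w;v\rangle_j=h_j\sum_{\mu=1}^N\omega_\mu\Big(\frac{w(x_j^{(\mu)})}{\rho_h^e(x_j^{(\mu)})}-\frac{\overline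 w_j}{\overline{(\rho_h^e)}_j}\Big)(p_{11,h}^e)_x(x_j^{(\mu)})v(x_j^{(\mu)})+\frac{\overline w_j}{\overline{(\rho_h^e)}_j}\Big(p_{11,j+\frac12}^{e,*}v(x_{j+\frac12}^-)-p_{11,j-\frac12}^{e,*}v(x_{j-\frac12}^+)-h_j\sum_{\mu=1}^N\omega_\mu p_{11,h}^e(x_j^{(\mu)})v_x(x_j^{(\mu)})\Big),$$ and $\langle S^{[2]},v\rangle_j=\langle\rho_h;v\rangle_j$, $\langle S^{[4]},v\rangle_j=\langle m_{1,h};v\rangle_j$, $\langle S^{[5]},v\rangle_j=\langle\tfrac12m_{2,h};v\rangle_j$. **Scheme.** Given $\mathbf U_h\in[\mathbb V_h^k]^6$ and a time step $\Delta t$, $\mathbf U_h^{\rm new}\in[\mathbb V_h^k]^6$ is determined by: for all $j$ and all $v\in\mathbb V_h^k$, $$\int_{I_j}\frac{\mathbf U_h^{\rm new}-\mathbf U_h}{\Delta t}v\,dx=h_j\sum_{\mu=1}^N\omega_\mu\mathbf F(\mathbf U_h(x_j^{(\mu)}))v_x(x_j^{(\mu)})-\big(\widehat{\mathbf F}_{j+\frac12}v(x_{j+\frac12}^-)-\widehat{\mathbf F}_{j-\frac12}v(x_{j-\frac12}^+)\big)+\big(0,\langle S^{[2]},v\rangle_j,0,\langle S^{[4]},v\rangle_j,\langle S^{[5]},v\rangle_j,0\big)^\top.$$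
   Formalization: The formal theorem assumes k ≤ 2N, so that the N-point Gauss rule integrates v_x exactly; without this the third component of the right-hand side need not vanish when C_0 ≠ 0 (e.g. N=1, k=3, v=(x−x_j)^3). *)

theory Defs
  imports "HOL-Analysis.Analysis" "HOL-Computational_Algebra.Polynomial"
begin

text \<open>States \<open>(\<rho>, m\<^sub>1, m\<^sub>2, E\<^sub>1\<^sub>1, E\<^sub>1\<^sub>2, E\<^sub>2\<^sub>2)\<close> are elements of \<open>real^6\<close>.\<close>

definition sym2 :: "'a::zero \<Rightarrow> 'a \<Rightarrow> 'a \<Rightarrow> 'a^2^2" where
  "sym2 a b c = vector [vector [a, b], vector [b, c]]"

definition pos_def :: "real^2^2 \<Rightarrow> bool" where
  "pos_def A \<longleftrightarrow> transpose A = A \<and> (\<forall>v. v \<noteq> 0 \<longrightarrow> 0 < v \<bullet> (A *v v))"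

definition density :: "real^6 \<Rightarrow> real" where
  "density U = U $ 1"

definition momentum :: "real^6 \<Rightarrow> real^2" where
  "momentum U = vector [U $ 2, U $ 3]"

definition energy :: "real^6 \<Rightarrow> real^2^2" where
  "energy U = sym2 (U $ 4) (U $ 5) (U $ 6)"

definition velocity :: "real^6 \<Rightarrow> real^2" where
  "velocity U = momentum U /\<^sub>R density U"

definition pressure :: "real^6 \<Rightarrow> real^2^2" where
  "pressure U = 2 *\<^sub>R energy U - (\<chi> a b. momentum U $ a * momentum U $ b / density U)"

definition flux :: "real^6 \<Rightarrow> real^6" where
  "flux U = (let \<rho> = density U; u1 = velocity U $ 1; u2 = velocity U $ 2;
                 E = energy U; p = pressure U in
     vector [\<rho> * u1,
             \<rho> * u1\<^sup>2 + p $ 1 $ 1,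
             \<rho> * u1 * u2 + p $ 1 $ 2,
             (E $ 1 $ 1 + p $ 1 $ 1) * u1,
             E $ 1 $ 2 * u1 + (p $ 1 $ 1 * u2 + p $ 1 $ 2 * u1) / 2,
             E $ 2 $ 2 * u1 + p $ 1 $ 2 * u2])"

text \<open>The HLLC flux enters as a parameter with its known contact property, exactness at a stationary
  contact, which is required only between physically admissible states. Nothing is fixed about the
  wave-speed estimates.\<close>

definition contact_property :: "(real^6 \<Rightarrow> real^6 \<Rightarrow> real^6) \<Rightarrow> bool" where
  "contact_property F \<longleftrightarrow>
     (\<forall>\<rho>L \<rho>R p11 p12 p22L p22R.
        0 < \<rho>L \<and> 0 < \<rho>R \<and> pos_def (sym2 p11 p12 p22L) \<and> pos_def (sym2 p11 p12 p22R) \<longrightarrow>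
        F (vector [\<rho>L, 0, 0, p11 / 2, p12 / 2, p22L / 2])
          (vector [\<rho>R, 0, 0, p11 / 2, p12 / 2, p22R / 2])
        = vector [0, p11, p12, 0, 0, 0])"

text \<open>Cell \<open>j \<in> {1..ncells M}\<close> is \<open>{face M (j - 1)<..<face M j}\<close>, so \<open>face M j\<close> is the point
  \<open>x\<^bsub>j+1/2\<^esub>\<close>.\<close>

record mesh =
  ncells :: nat
  face :: "nat \<Rightarrow> real"

definition valid_mesh :: "mesh \<Rightarrow> bool" where
  "valid_mesh M \<longleftrightarrow> 1 \<le> ncells M \<and> (\<forall>j\<in>{1..ncells M}. face M (j - 1) < face M j)"

definition closed_domain :: "mesh \<Rightarrow> real set" where
  "closed_domain M = {face M 0..face M (ncells M)}"

definition closed_cell :: "mesh \<Rightarrow> nat \<Rightarrow> real set" where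
  "closed_cell M j = {face M (j - 1)..face M j}"

definition cell_length :: "mesh \<Rightarrow> nat \<Rightarrow> real" where
  "cell_length M j = face M j - face M (j - 1)"

text \<open>A piecewise polynomial is given by its polynomial on each cell; its left and right limits at
  \<open>face M i\<close> are the values there of polynomials \<open>i\<close> and \<open>i + 1\<close>. The polynomials with index \<open>0\<close>
  and \<open>ncells M + 1\<close> carry the exterior limits at the two ends of the domain, that is, the boundary
  data (for instance periodic); only their values at \<open>face M 0\<close> and \<open>face M (ncells M)\<close> are ever
  used.\<close>

type_synonym dgfun = "nat \<Rightarrow> real poly"

definition Vh :: "mesh \<Rightarrow> nat \<Rightarrow> dgfun set" where
  "Vh M k = {g. \<forall>j\<in>{1..ncells M}. degree (g j) \<le> k}"

definition on_mesh :: "mesh \<Rightarrow> (nat \<Rightarrow> real \<Rightarrow> bool) \<Rightarrow> bool" where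
  "on_mesh M Q \<longleftrightarrow> (\<forall>j\<in>{1..ncells M}. \<forall>x\<in>closed_cell M j. Q j x) \<and>
                   Q 0 (face M 0) \<and> Q (ncells M + 1) (face M (ncells M))"

definition cell_average :: "mesh \<Rightarrow> nat \<Rightarrow> dgfun \<Rightarrow> real" where
  "cell_average M j g = integral (closed_cell M j) (poly (g j)) / cell_length M j"

record quadrature =
  npts :: nat
  node :: "nat \<Rightarrow> nat \<Rightarrow> real"
  weight :: "nat \<Rightarrow> real"

text \<open>\<open>node Q j \<mu>\<close> is \<open>x\<^sub>j\<^sup>(\<^sup>\<mu>\<^sup>)\<close>. The \<open>N\<close>-point Gauss rule is the \<open>N\<close>-point rule that is exact for
  polynomials of degree at most \<open>2N - 1\<close>; it integrates the derivatives of test functions of degree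
  at most \<open>k\<close> exactly when \<open>k \<le> 2N\<close>.\<close>

definition gauss_rule :: "mesh \<Rightarrow> quadrature \<Rightarrow> bool" where
  "gauss_rule M Q \<longleftrightarrow> 1 \<le> npts Q \<and> (\<Sum>\<mu>=1..npts Q. weight Q \<mu>) = 1 \<and>
     (\<forall>j\<in>{1..ncells M}.
        inj_on (node Q j) {1..npts Q} \<and>
        node Q j ` {1..npts Q} \<subseteq> {face M (j - 1)<..<face M j} \<and>
        (\<forall>q::real poly. degree q \<le> 2 * npts Q - 1 \<longrightarrow>
           cell_length M j * (\<Sum>\<mu>=1..npts Q. weight Q \<mu> * poly q (node Q j \<mu>))
           = integral (closed_cell M j) (poly q)))"

text \<open>Hydrostatic equilibrium for the potential \<open>W\<close>, with derivative \<open>Wx\<close>. Integrability is what a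
  projection onto the piecewise polynomials needs.\<close>

definition hydrostatic ::
  "mesh \<Rightarrow> (real \<Rightarrow> real) \<Rightarrow> (real \<Rightarrow> real) \<Rightarrow> real \<Rightarrow> (real \<Rightarrow> real^6) \<Rightarrow> bool" where
  "hydrostatic M W Wx C0 Ue \<longleftrightarrow>
     (\<lambda>x. density (Ue x)) integrable_on closed_domain M \<and>
     (\<lambda>x. pressure (Ue x)) integrable_on closed_domain M \<and>
     (\<forall>x\<in>closed_domain M.
        0 < density (Ue x) \<and> pos_def (pressure (Ue x)) \<and>
        (W has_real_derivative Wx x) (at x within closed_domain M) \<and>
        ((\<lambda>y. pressure (Ue y) $ 1 $ 1) has_real_derivative - (1 / 2) * density (Ue x) * Wx x)
          (at x within closed_domain M) \<and>
        pressure (Ue x) $ 1 $ 2 = C0 \<and>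
        velocity (Ue x) = 0)"

text \<open>Positive and positive-definite projections are not tied to one construction: any operators into
  the piecewise polynomials are admitted that preserve positivity, respectively positive
  definiteness and a constant off-diagonal entry, such as the \<open>L\<^sup>2\<close> projection followed by a
  positivity-preserving scaling limiter.\<close>

definition positive_projection :: "mesh \<Rightarrow> nat \<Rightarrow> ((real \<Rightarrow> real) \<Rightarrow> dgfun) \<Rightarrow> bool" where
  "positive_projection M k P \<longleftrightarrow>
     (\<forall>f. f integrable_on closed_domain M \<and> (\<forall>x\<in>closed_domain M. 0 < f x) \<longrightarrow>
        P f \<in> Vh M k \<and> on_mesh M (\<lambda>j x. 0 < poly (P f j) x))"

definition pos_def_projection ::
  "mesh \<Rightarrow> nat \<Rightarrow> ((real \<Rightarrow> real^2^2) \<Rightarrow> nat \<Rightarrow> real poly^2^2) \<Rightarrow> bool" where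
  "pos_def_projection M k P \<longleftrightarrow>
     (\<forall>p. p integrable_on closed_domain M \<and> (\<forall>x\<in>closed_domain M. pos_def (p x)) \<longrightarrow>
        (\<forall>a b. (\<lambda>j. P p j $ a $ b) \<in> Vh M k) \<and>
        on_mesh M (\<lambda>j x. pos_def (\<chi> a b. poly (P p j $ a $ b) x)) \<and>
        (\<forall>c. (\<forall>x\<in>closed_domain M. p x $ 1 $ 2 = c) \<longrightarrow>
             (\<forall>j\<le>ncells M + 1. P p j $ 1 $ 2 = [:c:])))"

text \<open>\<open>\<rho>\<^sub>h\<^sup>e\<close>, the diagonal of \<open>p\<^sub>h\<^sup>e\<close>, and its constant off-diagonal entry \<open>C\<^sub>0\<close>.\<close>

record projected_equilibrium =
  rho_e :: dgfun
  p11_e :: dgfun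
  p22_e :: dgfun
  C0_e :: real

definition projected ::
  "((real \<Rightarrow> real) \<Rightarrow> dgfun) \<Rightarrow> ((real \<Rightarrow> real^2^2) \<Rightarrow> nat \<Rightarrow> real poly^2^2) \<Rightarrow>
   real \<Rightarrow> (real \<Rightarrow> real^6) \<Rightarrow> projected_equilibrium" where
  "projected P\<rho> Pp C0 Ue =
     \<lparr> rho_e = P\<rho> (\<lambda>x. density (Ue x)),
       p11_e = (\<lambda>j. Pp (\<lambda>x. pressure (Ue x)) j $ 1 $ 1),
       p22_e = (\<lambda>j. Pp (\<lambda>x. pressure (Ue x)) j $ 2 $ 2),
       C0_e = C0 \<rparr>"

definition eval_state :: "real poly^6 \<Rightarrow> real \<Rightarrow> real^6" where
  "eval_state U x = (\<chi> c. poly (U $ c) x)"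

definition equilibrium_state :: "projected_equilibrium \<Rightarrow> nat \<Rightarrow> real poly^6" where
  "equilibrium_state eq j =
     vector [rho_e eq j, 0, 0, smult (1 / 2) (p11_e eq j), [:C0_e eq / 2:],
             smult (1 / 2) (p22_e eq j)]"

definition p11_star :: "mesh \<Rightarrow> projected_equilibrium \<Rightarrow> nat \<Rightarrow> real" where
  "p11_star M eq i = max (poly (p11_e eq i) (face M i)) (poly (p11_e eq (i + 1)) (face M i))"

text \<open>The matrix \<open>T\<close> at face \<open>i\<close> for the limit taken from cell \<open>j\<close>: \<open>T\<^sup>-\<close> is the case \<open>j = i\<close> and
  \<open>T\<^sup>+\<close> the case \<open>j = i + 1\<close>.\<close>

definition trans_mat :: "mesh \<Rightarrow> projected_equilibrium \<Rightarrow> nat \<Rightarrow> nat \<Rightarrow> real^2^2" where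
  "trans_mat M eq i j =
     (let p11 = poly (p11_e eq j) (face M i);
          p22 = poly (p22_e eq j) (face M i);
          t1 = sqrt (det (sym2 (p11_star M eq i) (C0_e eq) p22) / det (sym2 p11 (C0_e eq) p22));
          t2 = C0_e eq * (1 - t1) / p22
      in vector [vector [t1, t2], vector [0, 1]])"

definition transform_state :: "real^2^2 \<Rightarrow> real^6 \<Rightarrow> real^6" where
  "transform_state T U =
     (let m = T *v momentum U; E = T ** energy U ** transpose T in
      vector [density U, m $ 1, m $ 2, E $ 1 $ 1, E $ 1 $ 2, E $ 2 $ 2])"

definition numerical_flux ::
  "(real^6 \<Rightarrow> real^6 \<Rightarrow> real^6) \<Rightarrow> mesh \<Rightarrow> projected_equilibrium \<Rightarrow>
   (nat \<Rightarrow> real poly^6) \<Rightarrow> nat \<Rightarrow> real^6" where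
  "numerical_flux F M eq U i =
     F (transform_state (trans_mat M eq i i) (eval_state (U i) (face M i)))
       (transform_state (trans_mat M eq i (i + 1)) (eval_state (U (i + 1)) (face M i)))"

definition source_form ::
  "mesh \<Rightarrow> quadrature \<Rightarrow> projected_equilibrium \<Rightarrow> dgfun \<Rightarrow> dgfun \<Rightarrow> nat \<Rightarrow> real" where
  "source_form M Q eq w v j =
     (let h = cell_length M j; x = node Q j;
          r = cell_average M j w / cell_average M j (rho_e eq)
      in h * (\<Sum>\<mu>=1..npts Q. weight Q \<mu> * (poly (w j) (x \<mu>) / poly (rho_e eq j) (x \<mu>) - r)
                * poly (pderiv (p11_e eq j)) (x \<mu>) * poly (v j) (x \<mu>))
         + r * (p11_star M eq j * poly (v j) (face M j)
                - p11_star M eq (j - 1) * poly (v j) (face M (j - 1))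
                - h * (\<Sum>\<mu>=1..npts Q. weight Q \<mu> * poly (p11_e eq j) (x \<mu>)
                         * poly (pderiv (v j)) (x \<mu>))))"

definition dg_rhs ::
  "(real^6 \<Rightarrow> real^6 \<Rightarrow> real^6) \<Rightarrow> mesh \<Rightarrow> quadrature \<Rightarrow> projected_equilibrium \<Rightarrow>
   (nat \<Rightarrow> real poly^6) \<Rightarrow> dgfun \<Rightarrow> nat \<Rightarrow> real^6" where
  "dg_rhs F M Q eq U v j =
     cell_length M j *\<^sub>R
       (\<Sum>\<mu>=1..npts Q. (weight Q \<mu> * poly (pderiv (v j)) (node Q j \<mu>)) *\<^sub>R
                        flux (eval_state (U j) (node Q j \<mu>)))
     - (poly (v j) (face M j) *\<^sub>R numerical_flux F M eq U j
        - poly (v j) (face M (j - 1)) *\<^sub>R numerical_flux F M eq U (j - 1))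
     + vector [0,
               source_form M Q eq (\<lambda>i. U i $ 1) v j,
               0,
               source_form M Q eq (\<lambda>i. U i $ 2) v j,
               source_form M Q eq (\<lambda>i. smult (1 / 2) (U i $ 3)) v j,
               0]"

definition dg_step ::
  "(real^6 \<Rightarrow> real^6 \<Rightarrow> real^6) \<Rightarrow> mesh \<Rightarrow> quadrature \<Rightarrow> projected_equilibrium \<Rightarrow> nat \<Rightarrow> real \<Rightarrow>
   (nat \<Rightarrow> real poly^6) \<Rightarrow> (nat \<Rightarrow> real poly^6) \<Rightarrow> bool" where
  "dg_step F M Q eq k dt U Unew \<longleftrightarrow>
     (\<forall>c. (\<lambda>j. Unew j $ c) \<in> Vh M k) \<and>
     (\<forall>j\<in>{1..ncells M}. \<forall>v\<in>Vh M k.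
        integral (closed_cell M j)
          (\<lambda>x. poly (v j) x *\<^sub>R ((eval_state (Unew j) x - eval_state (U j) x) /\<^sub>R dt))
        = dg_rhs F M Q eq U v j)"

end

theory Submission
  imports Defs
begin

text \<open>At the projected equilibrium \<open>T\<close> carries \<open>p\<^sub>1\<^sub>1\<close> at each face to the common value \<open>p\<^sub>1\<^sub>1\<^sup>*\<close> and keeps
  \<open>C\<^sub>0\<close>, \<open>p\<^sub>2\<^sub>2\<close>, so both modified states form a stationary contact and the numerical flux is
  \<open>(0, p\<^sub>1\<^sub>1\<^sup>*, C\<^sub>0, 0, 0, 0)\<close>. Since \<open>w / \<rho>\<^sub>h\<^sup>e\<close> is constant (1 or 0) on each cell, the source collapses
  to the part that cancels the second flux component exactly. In the third component what remains is
  the quadrature error of \<open>C\<^sub>0 v\<^sub>x\<close>, which is zero. Finally, testing the step with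
  \<open>v = U\<^sup>n\<^sup>e\<^sup>w - U\<close>, component by component, gives \<open>U\<^sup>n\<^sup>e\<^sup>w = U\<close>.\<close>

section \<open>Vectors and matrices\<close>

lemma vector_6 [simp]:
  fixes a b c d e f :: "'a::zero"
  shows "(vector [a, b, c, d, e, f] :: 'a^6) $ 1 = a"
    and "(vector [a, b, c, d, e, f] :: 'a^6) $ 2 = b"
    and "(vector [a, b, c, d, e, f] :: 'a^6) $ 3 = c"
    and "(vector [a, b, c, d, e, f] :: 'a^6) $ 4 = d"
    and "(vector [a, b, c, d, e, f] :: 'a^6) $ 5 = e"
    and "(vector [a, b, c, d, e, f] :: 'a^6) $ 6 = f"
  unfolding vector_def by simp_all

lemma exhaust_6:
  fixes x :: 6
  shows "x = 1 \<or> x = 2 \<or> x = 3 \<or> x = 4 \<or> x = 5 \<or> x = 6"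
proof (induct x)
  case (of_int z)
  \<comment> \<open>The representatives of the type \<open>6\<close> are \<open>0\<close> to
    \<open>5\<close>, and the representative \<open>0\<close> is the index \<open>6\<close>.\<close>
  then have "z = 0 \<or> z = 1 \<or> z = 2 \<or> z = 3 \<or> z = 4 \<or> z = 5" by auto
  then show ?case by auto
qed

lemma forall_6: "(\<forall>i::6. P i) \<longleftrightarrow> P 1 \<and> P 2 \<and> P 3 \<and> P 4 \<and> P 5 \<and> P 6"
  by (metis exhaust_6)

lemma vec6_eq_iff:
  fixes x y :: "'a^6"
  shows "x = y \<longleftrightarrow> x $ 1 = y $ 1 \<and> x $ 2 = y $ 2 \<and> x $ 3 = y $ 3 \<and>
                  x $ 4 = y $ 4 \<and> x $ 5 = y $ 5 \<and> x $ 6 = y $ 6"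
  by (simp add: vec_eq_iff forall_6)

lemma sym2_nth [simp]:
  "sym2 a b c $ 1 $ 1 = a" "sym2 a b c $ 1 $ 2 = b"
  "sym2 a b c $ 2 $ 1 = b" "sym2 a b c $ 2 $ 2 = c"
  by (simp_all add: sym2_def)

lemma pos_def_sym2_iff:
  "pos_def (sym2 a b c) \<longleftrightarrow> (\<forall>x y. (x, y) \<noteq> (0, 0) \<longrightarrow> 0 < a * x\<^sup>2 + 2 * b * x * y + c * y\<^sup>2)"
proof -
  have form: "v \<bullet> (sym2 a b c *v v) = a * (v $ 1)\<^sup>2 + 2 * b * (v $ 1) * (v $ 2) + c * (v $ 2)\<^sup>2"
    for v :: "real^2"
    by (simp add: inner_vec_def matrix_vector_mult_def sum_2 algebra_simps power2_eq_square)
  have sym: "transpose (sym2 a b c) = sym2 a b c"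
    by (simp add: vec_eq_iff forall_2 transpose_def)
  have "(\<forall>v::real^2. v \<noteq> 0 \<longrightarrow> 0 < a * (v $ 1)\<^sup>2 + 2 * b * (v $ 1) * (v $ 2) + c * (v $ 2)\<^sup>2) \<longleftrightarrow>
        (\<forall>x y. (x, y) \<noteq> (0, 0) \<longrightarrow> 0 < a * x\<^sup>2 + 2 * b * x * y + c * y\<^sup>2)" (is "?L \<longleftrightarrow> ?R")
  proof
    assume L: ?L
    show ?R
    proof (intro allI impI)
      fix x y :: real
      assume "(x, y) \<noteq> (0, 0)"
      then have "(vector [x, y] :: real^2) \<noteq> 0"
        by (auto simp: vec_eq_iff forall_2)
      with L show "0 < a * x\<^sup>2 + 2 * b * x * y + c * y\<^sup>2"
        by (metis vector_2)
    qed
  next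
    assume ?R
    then show ?L
      by (auto simp: vec_eq_iff forall_2)
  qed
  then show ?thesis
    by (simp add: pos_def_def form sym)
qed

lemma pos_def_sym2D:
  assumes "pos_def (sym2 a b c)"
  shows "0 < a" "0 < c" "0 < a * c - b\<^sup>2"
proof -
  have q: "(x, y) \<noteq> (0, 0) \<Longrightarrow> 0 < a * x\<^sup>2 + 2 * b * x * y + c * y\<^sup>2" for x y
    using assms by (simp add: pos_def_sym2_iff)
  show a: "0 < a" using q[of 1 0] by simp
  show "0 < c" using q[of 0 1] by simp
  \<comment> \<open>For \<open>y = a\<close> the form is smallest at \<open>x = -b\<close>, where it
    equals \<open>a\<close> times the determinant.\<close>
  have "0 < a * (a * c - b\<^sup>2)"
    using q[of "-b" a] a by (simp add: algebra_simps power2_eq_square)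
  then show "0 < a * c - b\<^sup>2"
    using a by (simp add: zero_less_mult_iff)
qed

text \<open>The form grows by \<open>(a' - a) * x\<^sup>2\<close>. This is why raising
  \<open>p11\<close> to the maximum \<open>p11_star\<close> keeps the pressures on both sides of a
  face definite.\<close>

lemma pos_def_sym2_mono:
  assumes "pos_def (sym2 a b c)" "a \<le> a'"
  shows "pos_def (sym2 a' b c)"
  unfolding pos_def_sym2_iff
proof (intro allI impI)
  fix x y :: real
  assume "(x, y) \<noteq> (0, 0)"
  then have "0 < a * x\<^sup>2 + 2 * b * x * y + c * y\<^sup>2"
    using assms(1) by (simp add: pos_def_sym2_iff)
  moreover have "a * x\<^sup>2 \<le> a' * x\<^sup>2"
    using assms(2) by (simp add: mult_right_mono)
  ultimately show "0 < a' * x\<^sup>2 + 2 * b * x * y + c * y\<^sup>2" by linarith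
qed

section \<open>Polynomials on an interval\<close>

lemma has_integral_pderiv:
  fixes p :: "real poly"
  assumes "a \<le> b"
  shows "(poly (pderiv p) has_integral poly p b - poly p a) {a..b}"
  by (rule fundamental_theorem_of_calculus[OF assms])
     (auto simp: has_real_derivative_iff_has_vector_derivative[symmetric]
           intro: has_field_derivative_at_within poly_DERIV)

text \<open>Serves to show that the cell average of the density, a divisor in the source, is
  nonzero.\<close>

lemma integral_poly_pos:
  fixes p :: "real poly"
  assumes "a < b" "\<And>x. x \<in> {a..b} \<Longrightarrow> 0 < poly p x"
  shows "0 < integral {a..b} (poly p)"
proof -
  have cont: "continuous_on {a..b} (poly p)" by (intro continuous_intros)
  have "0 \<le> integral {a..b} (poly p)"
    by (rule integral_nonneg[OF integrable_continuous_real[OF cont]])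
       (simp add: assms(2) less_imp_le)
  moreover have "integral {a..b} (poly p) \<noteq> 0"
  proof
    assume "integral {a..b} (poly p) = 0"
    then have "\<forall>x\<in>{a..b}. poly p x = 0"
      by (subst (asm) integral_eq_0_iff[OF cont assms(1)]) (simp_all add: assms(2) less_imp_le)
    with assms show False by force
  qed
  ultimately show ?thesis by simp
qed

text \<open>A continuous nonnegative integrand with integral zero vanishes on the whole interval,
  and only the zero polynomial has infinitely many roots.\<close>

lemma integral_poly_square_eq_0_iff:
  fixes p :: "real poly"
  assumes "a < b"
  shows "integral {a..b} (\<lambda>x. poly p x * poly p x) = 0 \<longleftrightarrow> p = 0"
proof
  assume "integral {a..b} (\<lambda>x. poly p x * poly p x) = 0"
  then have "\<forall>x\<in>{a..b}. poly p x * poly p x = 0"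
    using integral_eq_0_iff[of a b "\<lambda>x. poly p x * poly p x"] assms
    by (simp add: continuous_on_mult continuous_on_poly)
  then have "{a..b} \<subseteq> {x. poly p x = 0}" by auto
  then show "p = 0"
    by (metis assms finite_subset infinite_Icc poly_roots_finite)
qed simp

section \<open>The scheme at equilibrium\<close>

text \<open>Without momentum the energy is half the pressure, so the last three parameters are
  pressure entries.\<close>

definition equilibrium_vec :: "real \<Rightarrow> real \<Rightarrow> real \<Rightarrow> real \<Rightarrow> real^6" where
  "equilibrium_vec \<rho> p11 p12 p22 = vector [\<rho>, 0, 0, p11 / 2, p12 / 2, p22 / 2]"

lemma eval_equilibrium_state:
  "eval_state (equilibrium_state eq j) x =
     equilibrium_vec (poly (rho_e eq j) x) (poly (p11_e eq j) x) (C0_e eq) (poly (p22_e eq j) x)"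
  by (simp add: vec6_eq_iff eval_state_def equilibrium_state_def equilibrium_vec_def)

lemma flux_equilibrium_vec: "flux (equilibrium_vec \<rho> p11 p12 p22) = vector [0, p11, p12, 0, 0, 0]"
  by (simp add: vec6_eq_iff flux_def Let_def velocity_def pressure_def momentum_def energy_def
        density_def equilibrium_vec_def)

lemma transform_state_equilibrium_vec:
  "transform_state (vector [vector [t1, t2], vector [0, 1]]) (equilibrium_vec \<rho> a b c) =
     equilibrium_vec \<rho> (t1\<^sup>2 * a + 2 * t1 * t2 * b + t2\<^sup>2 * c) (t1 * b + t2 * c) c"
  by (simp add: vec6_eq_iff transform_state_def Let_def equilibrium_vec_def momentum_def
        energy_def density_def matrix_vector_mult_def matrix_matrix_mult_def transpose_def sum_2
        power2_eq_square field_simps)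

text \<open>The entry \<open>t2\<close> of \<open>T\<close> is chosen to keep the off-diagonal
  entry, and \<open>det T = t1\<close> scales the determinant to the one belonging to
  \<open>p11_star\<close>. Since \<open>p22\<close> is kept and positive, the determinant fixes the
  remaining entry.\<close>

lemma transform_equilibrium_vec:
  assumes "pos_def (sym2 (poly (p11_e eq j) (face M i)) (C0_e eq) (poly (p22_e eq j) (face M i)))"
    and "poly (p11_e eq j) (face M i) \<le> p11_star M eq i"
  shows "transform_state (trans_mat M eq i j)
           (equilibrium_vec \<rho> (poly (p11_e eq j) (face M i)) (C0_e eq) (poly (p22_e eq j) (face M i)))
         = equilibrium_vec \<rho> (p11_star M eq i) (C0_e eq) (poly (p22_e eq j) (face M i))"
proof -
  define a where "a = poly (p11_e eq j) (face M i)"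
  define b where "b = C0_e eq"
  define c where "c = poly (p22_e eq j) (face M i)"
  define s where "s = p11_star M eq i"
  define t where "t = sqrt ((s * c - b\<^sup>2) / (a * c - b\<^sup>2))"
  note pd = assms(1)[folded a_def b_def c_def]
  have c: "0 < c" and D: "0 < a * c - b\<^sup>2" and D': "0 < s * c - b\<^sup>2"
    using pos_def_sym2D[OF pd] pos_def_sym2D[OF pos_def_sym2_mono[OF pd]] assms(2)
    by (auto simp: a_def s_def)
  have t2: "t\<^sup>2 * (a * c - b\<^sup>2) = s * c - b\<^sup>2"
    using D D' by (simp add: t_def)
  have T: "trans_mat M eq i j = vector [vector [t, b * (1 - t) / c], vector [0, 1]]"
    by (simp add: trans_mat_def Let_def det_2 t_def a_def b_def c_def s_def power2_eq_square)
  have e12: "t * b + b * (1 - t) / c * c = b"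
    using c by (simp add: field_simps)
  \<comment> \<open>\<open>c\<close> times the new (1,1) entry is the new determinant plus
    \<open>b\<^sup>2\<close>; this clears the denominators.\<close>
  have "c * (t\<^sup>2 * a + 2 * t * (b * (1 - t) / c) * b + (b * (1 - t) / c)\<^sup>2 * c)
        = t\<^sup>2 * (a * c - b\<^sup>2) + b\<^sup>2"
    using c by (simp add: field_simps power2_eq_square)
  also have "\<dots> = c * s" using t2 by (simp add: algebra_simps)
  finally have e11: "t\<^sup>2 * a + 2 * t * (b * (1 - t) / c) * b + (b * (1 - t) / c)\<^sup>2 * c = s"
    using c by simp
  show ?thesis
    unfolding a_def[symmetric] b_def[symmetric] c_def[symmetric] s_def[symmetric] T
      transform_state_equilibrium_vec e11 e12 ..
qed

lemma numerical_flux_equilibrium: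
  assumes "contact_property F"
    and "U i = equilibrium_state eq i" "U (i + 1) = equilibrium_state eq (i + 1)"
    and "\<And>j. j \<in> {i, i + 1} \<Longrightarrow> 0 < poly (rho_e eq j) (face M i)"
    and pd: "\<And>j. j \<in> {i, i + 1} \<Longrightarrow>
           pos_def (sym2 (poly (p11_e eq j) (face M i)) (C0_e eq) (poly (p22_e eq j) (face M i)))"
  shows "numerical_flux F M eq U i = vector [0, p11_star M eq i, C0_e eq, 0, 0, 0]"
proof -
  have le: "poly (p11_e eq j) (face M i) \<le> p11_star M eq i" if "j \<in> {i, i + 1}" for j
    using that by (auto simp: p11_star_def)
  \<comment> \<open>The contact property applies only to admissible states, so the modified
    pressures must be definite too.\<close>
  note pd' = pos_def_sym2_mono[OF pd le]
  have "F (equilibrium_vec (poly (rho_e eq i) (face M i)) (p11_star M eq i) (C0_e eq)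
             (poly (p22_e eq i) (face M i)))
          (equilibrium_vec (poly (rho_e eq (i + 1)) (face M i)) (p11_star M eq i) (C0_e eq)
             (poly (p22_e eq (i + 1)) (face M i))) = vector [0, p11_star M eq i, C0_e eq, 0, 0, 0]"
    using assms(1,4) pd' unfolding contact_property_def equilibrium_vec_def by blast
  then show ?thesis
    using pd[of i] pd[of "i + 1"] le[of i] le[of "i + 1"]
    unfolding numerical_flux_def assms(2,3) eval_equilibrium_state
    by (simp add: transform_equilibrium_vec)
qed

section \<open>Source term and Gauss quadrature\<close>

lemma source_form_zero:
  assumes "w j = 0"
  shows "source_form M Q eq w v j = 0"
proof -
  have "poly (0 :: real poly) = (\<lambda>_. 0)" by (simp add: fun_eq_iff)
  then have "cell_average M j w = 0" by (simp add: cell_average_def assms)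
  then show ?thesis by (simp add: source_form_def Let_def assms)
qed

text \<open>The nodal ratios and the ratio of averages are all 1, so the first sum vanishes term by
  term. The sum that is left also occurs in the flux term, so it cancels there whatever its
  quadrature error.\<close>

lemma source_form_rho_e:
  assumes "w j = rho_e eq j"
    and "cell_average M j (rho_e eq) \<noteq> 0"
    and "\<And>\<mu>. \<mu> \<in> {1..npts Q} \<Longrightarrow> poly (rho_e eq j) (node Q j \<mu>) \<noteq> 0"
  shows "source_form M Q eq w v j =
     p11_star M eq j * poly (v j) (face M j) - p11_star M eq (j - 1) * poly (v j) (face M (j - 1))
     - cell_length M j * (\<Sum>\<mu>=1..npts Q. weight Q \<mu> * poly (p11_e eq j) (node Q j \<mu>)
                             * poly (pderiv (v j)) (node Q j \<mu>))"
proof -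
  have "cell_average M j w = cell_average M j (rho_e eq)"
    by (simp add: cell_average_def assms(1))
  then show ?thesis
    using assms by (simp add: source_form_def Let_def)
qed

text \<open>Differentiation lowers the degree by one, so exactness up to
  \<open>2 * npts Q - 1\<close> suffices; the fundamental theorem then gives the face
  values.\<close>

lemma gauss_rule_pderiv:
  assumes "gauss_rule M Q" "j \<in> {1..ncells M}" "face M (j - 1) \<le> face M j"
    and "degree p \<le> 2 * npts Q"
  shows "cell_length M j * (\<Sum>\<mu>=1..npts Q. weight Q \<mu> * poly (pderiv p) (node Q j \<mu>))
         = poly p (face M j) - poly p (face M (j - 1))"
proof -
  have "degree (pderiv p) \<le> 2 * npts Q - 1"
    using assms(4) by (simp add: degree_pderiv)
  then have "cell_length M j * (\<Sum>\<mu>=1..npts Q. weight Q \<mu> * poly (pderiv p) (node Q j \<mu>))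
      = integral (closed_cell M j) (poly (pderiv p))"
    using assms(1,2) by (simp add: gauss_rule_def)
  then show ?thesis
    using integral_unique[OF has_integral_pderiv[OF assms(3), of p]]
    by (simp add: closed_cell_def)
qed

lemma dg_rhs_equilibrium:
  assumes mesh: "valid_mesh M" and gauss: "gauss_rule M Q" and "contact_property F"
    and rho: "on_mesh M (\<lambda>j x. 0 < poly (rho_e eq j) x)"
    and pd: "on_mesh M (\<lambda>j x. pos_def (sym2 (poly (p11_e eq j) x) (C0_e eq) (poly (p22_e eq j) x)))"
    and U: "\<And>j. j \<le> ncells M + 1 \<Longrightarrow> U j = equilibrium_state eq j"
    and j: "j \<in> {1..ncells M}" and deg: "degree (v j) \<le> 2 * npts Q"
  shows "dg_rhs F M Q eq U v j = 0"
proof -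
  have less: "face M (l - 1) < face M l" if "l \<in> {1..ncells M}" for l
    using mesh that by (simp add: valid_mesh_def)
  \<comment> \<open>Both one-sided limits at every face are covered by \<open>on_mesh\<close>; at
    the two ends of the domain one of them is exterior data.\<close>
  have face: "R l (face M i)"
    if R: "on_mesh M R" and i: "i \<le> ncells M" and l: "l \<in> {i, i + 1}" for R i l
  proof (cases "l \<in> {1..ncells M}")
    case True
    then have "face M i \<in> closed_cell M l"
      using l less[of l] by (auto simp: closed_cell_def)
    with R True show ?thesis by (simp add: on_mesh_def)
  next
    case False
    then have "l = 0 \<and> i = 0 \<or> l = ncells M + 1 \<and> i = ncells M"
      using i l by auto
    with R show ?thesis by (auto simp: on_mesh_def)
  qed
  have nf: "numerical_flux F M eq U i = vector [0, p11_star M eq i, C0_e eq, 0, 0, 0]"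
    if "i \<le> ncells M" for i
    using assms(3) that face[OF rho] face[OF pd]
    by (intro numerical_flux_equilibrium) (auto intro: U)
  have Uj: "U j = equilibrium_state eq j" using j by (simp add: U)
  have rho_pos: "0 < poly (rho_e eq j) x" if "x \<in> closed_cell M j" for x
    using rho j that by (simp add: on_mesh_def)
  have avg: "cell_average M j (rho_e eq) \<noteq> 0"
    using integral_poly_pos[OF less[OF j]] rho_pos less[OF j]
    by (force simp: cell_average_def closed_cell_def cell_length_def)
  have node: "poly (rho_e eq j) (node Q j \<mu>) \<noteq> 0" if "\<mu> \<in> {1..npts Q}" for \<mu>
  proof -
    have "node Q j \<mu> \<in> closed_cell M j"
      using gauss j that
      by (simp add: gauss_rule_def closed_cell_def image_subset_iff less_imp_le)
    then show ?thesis using rho_pos by force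
  qed
  have s1: "source_form M Q eq (\<lambda>i. U i $ 1) v j =
     p11_star M eq j * poly (v j) (face M j) - p11_star M eq (j - 1) * poly (v j) (face M (j - 1))
     - cell_length M j * (\<Sum>\<mu>=1..npts Q. weight Q \<mu> * poly (p11_e eq j) (node Q j \<mu>)
                             * poly (pderiv (v j)) (node Q j \<mu>))"
    by (rule source_form_rho_e) (use avg node in \<open>simp_all add: Uj equilibrium_state_def\<close>)
  have s2: "source_form M Q eq (\<lambda>i. U i $ 2) v j = 0"
    and s3: "source_form M Q eq (\<lambda>i. smult (1 / 2) (U i $ 3)) v j = 0"
    by (rule source_form_zero; simp add: Uj equilibrium_state_def)+
  \<comment> \<open>The factor \<open>C0_e eq\<close> gives the identity the shape in which the
    third component needs it.\<close>
  have g: "C0_e eq * (cell_length M j * (\<Sum>\<mu>=1..npts Q. weight Q \<mu> * poly (pderiv (v j)) (node Q j \<mu>)))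
      = C0_e eq * (poly (v j) (face M j) - poly (v j) (face M (j - 1)))"
    using gauss_rule_pderiv[OF gauss j less_imp_le[OF less[OF j]] deg] by simp
  have fl: "flux (eval_state (U j) x) = vector [0, poly (p11_e eq j) x, C0_e eq, 0, 0, 0]" for x
    by (simp add: Uj eval_equilibrium_state flux_equilibrium_vec)
  have nfs: "numerical_flux F M eq U j = vector [0, p11_star M eq j, C0_e eq, 0, 0, 0]"
    "numerical_flux F M eq U (j - 1) = vector [0, p11_star M eq (j - 1), C0_e eq, 0, 0, 0]"
    using j by (auto intro: nf)
  show ?thesis
    unfolding dg_rhs_def s1 s2 s3 fl nfs
    using g by (simp add: vec6_eq_iff sum_distrib_left sum_distrib_right algebra_simps)
qed

text \<open>The mass form is definite on each cell, so a vanishing right-hand side forces a zero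
  increment. Equality is claimed on the cells only, as the exterior polynomials are boundary
  data.\<close>

lemma dg_step_iff_unchanged:
  assumes mesh: "valid_mesh M" and "dt \<noteq> 0"
    and rhs: "\<And>j v. j \<in> {1..ncells M} \<Longrightarrow> v \<in> Vh M k \<Longrightarrow> dg_rhs F M Q eq U v j = 0"
    and UV: "\<And>c. (\<lambda>j. U j $ c) \<in> Vh M k"
  shows "dg_step F M Q eq k dt U Unew \<longleftrightarrow> (\<forall>j\<in>{1..ncells M}. Unew j = U j)"
proof
  assume step: "dg_step F M Q eq k dt U Unew"
  show "\<forall>j\<in>{1..ncells M}. Unew j = U j"
  proof
    fix j assume j: "j \<in> {1..ncells M}"
    show "Unew j = U j"
      unfolding vec_eq_iff
    proof
      fix c
      define d where "d = Unew j $ c - U j $ c"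
      have "degree (Unew j $ c) \<le> k" "degree (U j $ c) \<le> k"
        using step UV[of c] j by (auto simp: dg_step_def Vh_def)
      \<comment> \<open>The same polynomial may stand on every cell, since \<open>Vh\<close> only
        bounds degrees and cell \<open>j\<close> sees only its own member.\<close>
      then have "(\<lambda>_. d) \<in> Vh M k"
        by (simp add: Vh_def d_def degree_diff_le)
      then have I: "integral (closed_cell M j)
          (\<lambda>x. poly d x *\<^sub>R ((eval_state (Unew j) x - eval_state (U j) x) /\<^sub>R dt)) = 0"
        using step rhs j by (force simp: dg_step_def)
      have "(\<lambda>x. poly d x *\<^sub>R ((eval_state (Unew j) x - eval_state (U j) x) /\<^sub>R dt))
          integrable_on closed_cell M j"
        unfolding closed_cell_def eval_state_def
        \<comment> \<open>Integrability allows component \<open>c\<close> to be taken inside the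
          vector-valued integral.\<close>
        by (intro integrable_continuous_real continuous_intros continuous_on_vec_lambda)
      from integral_component_eq_cart[OF this, of c] have "integral (closed_cell M j)
          (\<lambda>x. (poly d x *\<^sub>R ((eval_state (Unew j) x - eval_state (U j) x) /\<^sub>R dt)) $ c) = 0"
        unfolding I by simp
      also have "(\<lambda>x. (poly d x *\<^sub>R ((eval_state (Unew j) x - eval_state (U j) x) /\<^sub>R dt)) $ c) =
          (\<lambda>x. inverse dt * (poly d x * poly d x))"
        by (simp add: eval_state_def d_def fun_eq_iff)
      finally have "integral {face M (j - 1)..face M j} (\<lambda>x. poly d x * poly d x) = 0"
        using \<open>dt \<noteq> 0\<close> by (simp add: closed_cell_def)
      moreover have "face M (j - 1) < face M j"
        using mesh j by (simp add: valid_mesh_def)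
      ultimately have "d = 0"
        by (simp add: integral_poly_square_eq_0_iff)
      then show "Unew j $ c = U j $ c"
        by (simp add: d_def)
    qed
  qed
next
  assume same: "\<forall>j\<in>{1..ncells M}. Unew j = U j"
  then have "(\<lambda>j. Unew j $ c) \<in> Vh M k" for c
    using UV[of c] by (simp add: Vh_def)
  then show "dg_step F M Q eq k dt U Unew"
    using same rhs by (simp add: dg_step_def)
qed

text \<open>Hydrostatic profiles meet the premises of both projections, and the constant
  off-diagonal entry survives projection, which yields the \<open>sym2\<close> form.\<close>

lemma projected_admissible:
  assumes "hydrostatic M W Wx C0 Ue"
    and "positive_projection M k P\<rho>" and "pos_def_projection M k Pp"
    and eq: "eq = projected P\<rho> Pp C0 Ue"
  shows "rho_e eq \<in> Vh M k" "p11_e eq \<in> Vh M k" "p22_e eq \<in> Vh M k"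
    and "on_mesh M (\<lambda>j x. 0 < poly (rho_e eq j) x)"
    and "on_mesh M (\<lambda>j x. pos_def (sym2 (poly (p11_e eq j) x) (C0_e eq) (poly (p22_e eq j) x)))"
proof -
  let ?\<rho> = "\<lambda>x. density (Ue x)" and ?p = "\<lambda>x. pressure (Ue x)"
  have "?\<rho> integrable_on closed_domain M" "\<forall>x\<in>closed_domain M. 0 < ?\<rho> x"
    using assms(1) by (auto simp: hydrostatic_def)
  then show "rho_e eq \<in> Vh M k" "on_mesh M (\<lambda>j x. 0 < poly (rho_e eq j) x)"
    using assms(2) by (auto simp: positive_projection_def eq projected_def)
  have "?p integrable_on closed_domain M" "\<forall>x\<in>closed_domain M. pos_def (?p x)"
    and const: "\<forall>x\<in>closed_domain M. ?p x $ 1 $ 2 = C0"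
    using assms(1) by (auto simp: hydrostatic_def)
  then have V: "(\<lambda>j. Pp ?p j $ a $ b) \<in> Vh M k"
    and pd: "on_mesh M (\<lambda>j x. pos_def (\<chi> a b. poly (Pp ?p j $ a $ b) x))"
    and C: "\<forall>c. (\<forall>x\<in>closed_domain M. ?p x $ 1 $ 2 = c) \<longrightarrow> (\<forall>j\<le>ncells M + 1. Pp ?p j $ 1 $ 2 = [:c:])"
    for a b
    using assms(3) unfolding pos_def_projection_def by blast+
  show "p11_e eq \<in> Vh M k" "p22_e eq \<in> Vh M k"
    using V by (simp_all add: eq projected_def)
  have "pos_def (sym2 (poly (p11_e eq j) x) (C0_e eq) (poly (p22_e eq j) x))"
    if "pos_def (\<chi> a b. poly (Pp ?p j $ a $ b) x)" and "j \<le> ncells M + 1" for j x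
  proof -
    let ?A = "(\<chi> a b. poly (Pp ?p j $ a $ b) x) :: real^2^2"
    have p12: "?A $ 1 $ 2 = C0" using C[rule_format, of C0 j] const that(2) by simp
    \<comment> \<open>The lower left entry is known only through the symmetry contained in
      \<open>pos_def\<close>.\<close>
    have "transpose ?A $ 1 $ 2 = ?A $ 1 $ 2"
      using that(1) by (simp only: pos_def_def)
    then have "?A $ 2 $ 1 = ?A $ 1 $ 2" by (simp add: transpose_def)
    with p12 have "?A = sym2 (poly (p11_e eq j) x) (C0_e eq) (poly (p22_e eq j) x)"
      by (simp add: vec_eq_iff forall_2 eq projected_def)
    with that(1) show ?thesis by simp
  qed
  with pd show "on_mesh M (\<lambda>j x. pos_def (sym2 (poly (p11_e eq j) x) (C0_e eq) (poly (p22_e eq j) x)))"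
    by (auto simp: on_mesh_def)
qed

theorem theorem3p4:
  fixes M :: mesh and Q :: quadrature and k :: nat and dt :: real
    and W Wx :: "real \<Rightarrow> real" and C0 :: real and Ue :: "real \<Rightarrow> real^6"
    and P\<rho> :: "(real \<Rightarrow> real) \<Rightarrow> dgfun"
    and Pp :: "(real \<Rightarrow> real^2^2) \<Rightarrow> nat \<Rightarrow> real poly^2^2"
    and F_hllc :: "real^6 \<Rightarrow> real^6 \<Rightarrow> real^6"
    and U :: "nat \<Rightarrow> real poly^6"
    and eq :: projected_equilibrium
  assumes "valid_mesh M"
    and "gauss_rule M Q" and "k \<le> 2 * npts Q"
    and "0 < dt"
    and "contact_property F_hllc"
    and "hydrostatic M W Wx C0 Ue"
    and "positive_projection M k P\<rho>" and "pos_def_projection M k Pp"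
    and "eq = projected P\<rho> Pp C0 Ue"
    and "\<forall>j\<le>ncells M + 1. U j = equilibrium_state eq j"
  shows "(\<forall>j\<in>{1..ncells M}. \<forall>v\<in>Vh M k. dg_rhs F_hllc M Q eq U v j = 0) \<and>
         (\<forall>Unew. dg_step F_hllc M Q eq k dt U Unew \<longleftrightarrow> (\<forall>j\<in>{1..ncells M}. Unew j = U j))"
proof -
  note adm = projected_admissible[OF assms(6-9)]
  have rhs: "dg_rhs F_hllc M Q eq U v j = 0" if "j \<in> {1..ncells M}" "v \<in> Vh M k" for j v
    using assms(1-3,5,10) adm(4,5) that by (intro dg_rhs_equilibrium) (auto simp: Vh_def intro: order_trans)
  have "degree (U j $ c) \<le> k" if "j \<in> {1..ncells M}" for j c
  proof -
    \<comment> \<open>Each component is zero, constant or a multiple of a projected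
      function.\<close>
    have "\<forall>c. degree (U j $ c) \<le> k"
      using adm(1-3) that assms(10) by (simp add: forall_6 equilibrium_state_def Vh_def)
    then show ?thesis ..
  qed
  then have "(\<lambda>j. U j $ c) \<in> Vh M k" for c
    by (simp add: Vh_def)
  then show ?thesis
    using rhs dg_step_iff_unchanged[OF assms(1) _ rhs] assms(4) by auto
qed

end
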